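(* Let $n\ge 1$ and let $\Pi$ be the group of all similarity transformations of $\mathbb{R}^n$, i.e. the group of affine transformations generated by all shifts (translations) and by the invertible linear transformations of $\mathbb{R}^n$ preserving orthogonality. Let $K_0\in W_n$ be a convex body. 1. Let $x_0\in \operatorname{Int} K_0$ be a $\Pi_{K_0}$-invariant point. Then there exists a similarity-invariant point of the body $p:W_n\to\mathbb{R}^n$ such that $p(K_0)=x_0$. 2. Let $x_0\in\mathbb{R}^n$ be an arbitrary $\Pi_{K_0}$-invariant point. Then there exists a similarity-invariant point $p:W_n\to\mathbb{R}^n$ such that $p(K_0)=x_0$. In other words, for every convex body $K\in W_n$, the set of all $\Pi_K$-invariant points in $\mathbb{R}^n$ coincides with the set of values $p(K)$, where $p$ ranges over all similarity-invariant points.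
   Context: $W_n$ denotes the set of all compact convex subsets of $\mathbb{R}^n$ with non-empty interior (called convex bodies), equipped with the topology of the Hausdorff metric. The linear transformations preserving orthogonality are exactly the maps $cU$ with $c>0$ and $U\in O(n)$; thus $\Pi$ consists of the maps $x\mapsto cUx+b$ with $c>0$, $U\in O(n)$, $b\in\mathbb{R}^n$. A similarity-invariant point is a continuous mapping $p:W_n\to\mathbb{R}^n$ such that $p(A(K))=A(p(K))$ for all $K\in W_n$ and all $A\in\Pi$. A similarity-invariant point of the body is a similarity-invariant point $p$ such that $p(K)\in K$ for all $K\in W_n$. For $K\in W_n$, $\Pi_K=\{A\in\Pi : A(K)=K\}$ is the subgroup of similarity automorphisms of $K$. A point $x_0\in\mathbb{R}^n$ is called $\Pi_K$-invariant if $A(x_0)=x_0$ for all $A\in\Pi_K$. $\operatorname{Int} K$ is the interior of $K$. *)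

theory Defs
  imports "HOL-Analysis.Analysis"
begin

definition convex_bodies :: "(real ^ 'n) set set" where
  "convex_bodies = {K. compact K \<and> convex K \<and> interior K \<noteq> {}}"

text \<open>The Hausdorff distance is extended by \<open>0\<close> to the pairs for which the supremum is not a
  real number, because \<open>Metric_space\<close> demands symmetry and nonnegativity of the distance
  function on the whole type and not only on the carrier.\<close>

definition hausdorff_dist :: "'a::metric_space set \<Rightarrow> 'a set \<Rightarrow> real" where
  "hausdorff_dist K L =
    (let D = (\<lambda>x. infdist x L) ` K \<union> (\<lambda>y. infdist y K) ` L
     in if D \<noteq> {} \<and> bdd_above D then Sup D else 0)"

definition convex_body_topology :: "(real ^ 'n) set topology" where
  "convex_body_topology = Metric_space.mtopology convex_bodies hausdorff_dist"

inductive_set similarities :: "(real ^ 'n \<Rightarrow> real ^ 'n) set" where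
  shift: "(\<lambda>x. x + b) \<in> similarities"
| linear: "\<lbrakk>linear f; bij f; \<And>x y. orthogonal x y \<Longrightarrow> orthogonal (f x) (f y)\<rbrakk> \<Longrightarrow> f \<in> similarities"
| comp: "\<lbrakk>A \<in> similarities; B \<in> similarities\<rbrakk> \<Longrightarrow> A \<circ> B \<in> similarities"
| inverse: "A \<in> similarities \<Longrightarrow> inv A \<in> similarities"

definition similarity_automorphisms :: "(real ^ 'n) set \<Rightarrow> (real ^ 'n \<Rightarrow> real ^ 'n) set" where
  "similarity_automorphisms K = {A \<in> similarities. A ` K = K}"

definition automorphism_invariant :: "(real ^ 'n) set \<Rightarrow> real ^ 'n \<Rightarrow> bool" where
  "automorphism_invariant K x \<longleftrightarrow> (\<forall>A \<in> similarity_automorphisms K. A x = x)"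

text \<open>A map \<open>p\<close> on convex bodies is a total function on sets; its values outside
  \<open>convex_bodies\<close> play no role.\<close>

definition similarity_invariant_point :: "((real ^ 'n) set \<Rightarrow> real ^ 'n) \<Rightarrow> bool" where
  "similarity_invariant_point p \<longleftrightarrow>
    continuous_map convex_body_topology euclidean p \<and>
    (\<forall>K \<in> convex_bodies. \<forall>A \<in> similarities. p (A ` K) = A (p K))"

definition similarity_invariant_point_of_body :: "((real ^ 'n) set \<Rightarrow> real ^ 'n) \<Rightarrow> bool" where
  "similarity_invariant_point_of_body p \<longleftrightarrow>
    similarity_invariant_point p \<and> (\<forall>K \<in> convex_bodies. p K \<in> K)"

lemma hausdorff_dist_commute: "hausdorff_dist K L = hausdorff_dist L K"
  by (simp add: hausdorff_dist_def Un_commute)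

lemma hausdorff_dist_nonneg: "0 \<le> hausdorff_dist K L"
proof -
  define D where "D = (\<lambda>x. infdist x L) ` K \<union> (\<lambda>y. infdist y K) ` L"
  have "0 \<le> Sup D" if D: "D \<noteq> {}" "bdd_above D"
  proof -
    obtain d where d: "d \<in> D"
      using D by blast
    then have "0 \<le> d"
      by (auto simp: D_def infdist_nonneg)
    also have "d \<le> Sup D"
      using d D(2) by (rule cSup_upper)
    finally show ?thesis .
  qed
  then show ?thesis
    unfolding hausdorff_dist_def Let_def D_def[symmetric] by simp
qed

lemma
  assumes "compact K" "compact L" "K \<noteq> {}" "L \<noteq> {}"
  shows hausdorff_dist_compact:
      "hausdorff_dist K L = max (SUP x\<in>K. infdist x L) (SUP y\<in>L. infdist y K)"
    and infdist_le_hausdorff_dist: "x \<in> K \<Longrightarrow> infdist x L \<le> hausdorff_dist K L"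
    and hausdorff_dist_le:
      "\<lbrakk>\<And>x. x \<in> K \<Longrightarrow> infdist x L \<le> r; \<And>y. y \<in> L \<Longrightarrow> infdist y K \<le> r\<rbrakk> \<Longrightarrow> hausdorff_dist K L \<le> r"
proof -
  define D where "D = (\<lambda>x. infdist x L) ` K \<union> (\<lambda>y. infdist y K) ` L"
  have bdd: "bdd_above ((\<lambda>x. infdist x B) ` A)" if "compact A" for A B :: "'a set"
    using that
    by (intro bounded_imp_bdd_above compact_imp_bounded compact_continuous_image
        continuous_on_infdist continuous_on_id)
  have eq: "hausdorff_dist K L = Sup D" and D: "bdd_above D" "D \<noteq> {}"
    using assms bdd by (auto simp: hausdorff_dist_def Let_def D_def)
  show "hausdorff_dist K L = max (SUP x\<in>K. infdist x L) (SUP y\<in>L. infdist y K)"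
    unfolding eq D_def using assms bdd by (subst cSup_union_distrib) (auto simp: sup_max)
  show "infdist x L \<le> hausdorff_dist K L" if "x \<in> K"
    unfolding eq using that D by (intro cSup_upper) (auto simp: D_def)
  show "hausdorff_dist K L \<le> r"
    if "\<And>x. x \<in> K \<Longrightarrow> infdist x L \<le> r" "\<And>y. y \<in> L \<Longrightarrow> infdist y K \<le> r"
    unfolding eq using that D by (intro cSup_least) (auto simp: D_def)
qed

lemma convex_bodiesD:
  assumes "K \<in> convex_bodies"
  shows "compact K" "convex K" "interior K \<noteq> {}" "K \<noteq> {}"
  using assms interior_subset by (auto simp: convex_bodies_def)

lemma Metric_space_convex_bodies: "Metric_space convex_bodies hausdorff_dist"
proof
  fix K L M :: "(real ^ 'n) set"
  show "0 \<le> hausdorff_dist K L"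
    by (rule hausdorff_dist_nonneg)
  show "hausdorff_dist K L = hausdorff_dist L K"
    by (rule hausdorff_dist_commute)
  assume "K \<in> convex_bodies" "L \<in> convex_bodies"
  note K = convex_bodiesD[OF this(1)] and L = convex_bodiesD[OF this(2)]
  have sub: "A \<subseteq> B" if "hausdorff_dist A B = 0" "compact A" "compact B" "A \<noteq> {}" "B \<noteq> {}"
    for A B :: "(real ^ 'n) set"
  proof
    fix x assume "x \<in> A"
    then have "infdist x B = 0"
      using infdist_le_hausdorff_dist[OF that(2-5), of x] that(1) infdist_nonneg[of x B] by simp
    then show "x \<in> B"
      using in_closed_iff_infdist_zero[OF compact_imp_closed[OF that(3)] that(5)] by simp
  qed
  show "hausdorff_dist K L = 0 \<longleftrightarrow> K = L"
  proof
    assume "hausdorff_dist K L = 0"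
    then show "K = L"
      using sub[of K L] sub[of L K] K(1,4) L(1,4) hausdorff_dist_commute[of K L] by simp
  next
    assume "K = L"
    moreover have "hausdorff_dist K K \<le> 0"
      using K(1,4) by (intro hausdorff_dist_le) simp_all
    ultimately show "hausdorff_dist K L = 0"
      using hausdorff_dist_nonneg[of K L] by simp
  qed
  assume "M \<in> convex_bodies"
  note M = convex_bodiesD[OF this]
  have *: "infdist x C \<le> hausdorff_dist A B + hausdorff_dist B C"
    if ABC: "x \<in> A" "compact A" "compact B" "compact C" "A \<noteq> {}" "B \<noteq> {}" "C \<noteq> {}"
    for x and A B C :: "(real ^ 'n) set"
  proof -
    obtain y where y: "y \<in> B" "infdist x B = dist x y"
      using infdist_attains_inf[OF compact_imp_closed[OF ABC(3)] ABC(6)] by blast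
    have "infdist x C \<le> infdist y C + dist x y"
      by (rule infdist_triangle)
    also have "\<dots> \<le> hausdorff_dist B C + hausdorff_dist A B"
      using infdist_le_hausdorff_dist[OF ABC(2,3,5,6,1)]
        infdist_le_hausdorff_dist[OF ABC(3,4,6,7) y(1)] y(2)
      by linarith
    finally show ?thesis
      by simp
  qed
  show "hausdorff_dist K M \<le> hausdorff_dist K L + hausdorff_dist L M"
  proof (rule hausdorff_dist_le)
    show "infdist x M \<le> hausdorff_dist K L + hausdorff_dist L M" if "x \<in> K" for x
      using that K(1) L(1) M(1) K(4) L(4) M(4) by (rule *)
    show "infdist y K \<le> hausdorff_dist K L + hausdorff_dist L M" if "y \<in> M" for y
      using *[OF that M(1) L(1) K(1) M(4) L(4) K(4)]
      by (simp only: hausdorff_dist_commute[of M] hausdorff_dist_commute[of L K] add.commute)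
  qed (fact K(1) M(1) K(4) M(4))+
qed

lemma orthogonality_preserving_imp_conformal:
  fixes f :: "real ^ 'n \<Rightarrow> real ^ 'n"
  assumes f: "linear f" "bij f" and orth: "\<And>x y. orthogonal x y \<Longrightarrow> orthogonal (f x) (f y)"
  obtains c U where "c > 0" "orthogonal_transformation U" "f = (\<lambda>x. c *\<^sub>R U x)"
proof -
  have eq: "norm (f x) = norm (f y)" if "norm x = norm y" for x y
  proof -
    have "orthogonal (x + y) (x - y)"
      using that by (simp add: orthogonal_def algebra_simps inner_commute dot_square_norm)
    then have "orthogonal (f x + f y) (f x - f y)"
      using orth linear_add[OF f(1)] linear_diff[OF f(1)] by metis
    then have "f x \<bullet> f x = f y \<bullet> f y"
      by (simp add: orthogonal_def algebra_simps inner_commute)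
    then show ?thesis
      by (simp add: norm_eq_sqrt_inner)
  qed
  obtain e :: "real ^ 'n" where e: "norm e = 1"
    using vector_choose_size[of 1] by auto
  define c where "c = norm (f e)"
  have norm_f: "norm (f x) = c * norm x" for x
    using eq[of x "norm x *\<^sub>R e"] e by (simp add: linear_cmul[OF f(1)] c_def)
  have "f e \<noteq> 0"
    using e f(2) linear_injective_0[OF f(1)] by (auto simp: bij_def)
  then have c: "c > 0"
    by (simp add: c_def)
  show thesis
  proof
    show "orthogonal_transformation (\<lambda>x. (1 / c) *\<^sub>R f x)"
      using f(1) c norm_f by (simp add: orthogonal_transformation linear_compose_scale_right)
    show "f = (\<lambda>x. c *\<^sub>R (1 / c) *\<^sub>R f x)"
      using c by simp
  qed (fact c)
qed

lemma similarities_eq: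
  "similarities = {\<lambda>x :: real ^ 'n. c *\<^sub>R U x + b | c U b. c > 0 \<and> orthogonal_transformation U}"
  (is "_ = ?S")
proof (intro equalityI subsetI)
  fix A :: "real ^ 'n \<Rightarrow> real ^ 'n"
  assume "A \<in> similarities"
  then show "A \<in> ?S"
  proof induction
    case (shift b)
    have "(\<lambda>x. x + b) = (\<lambda>x. 1 *\<^sub>R id x + b)" "(0::real) < 1"
      "orthogonal_transformation (id :: real ^ 'n \<Rightarrow> real ^ 'n)"
      by (simp_all add: orthogonal_transformation_def linear_id)
    then show ?case
      by blast
  next
    case (linear f)
    then obtain c U where "c > 0" "orthogonal_transformation U" "f = (\<lambda>x. c *\<^sub>R U x)"
      using orthogonality_preserving_imp_conformal by metis
    then have "f = (\<lambda>x. c *\<^sub>R U x + 0)"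
      by simp
    then show ?case
      using \<open>c > 0\<close> \<open>orthogonal_transformation U\<close> by blast
  next
    case (comp A B)
    then obtain c U b c' U' b' where A: "A = (\<lambda>x. c *\<^sub>R U x + b)" "c > 0" "orthogonal_transformation U"
      and B: "B = (\<lambda>x. c' *\<^sub>R U' x + b')" "c' > 0" "orthogonal_transformation U'"
      by blast
    have U: "linear U"
      using A(3) by (simp add: orthogonal_transformation)
    have "A \<circ> B = (\<lambda>x. (c * c') *\<^sub>R (U \<circ> U') x + (c *\<^sub>R U b' + b))"
      unfolding A(1) B(1)
      by (simp add: fun_eq_iff linear_add[OF U] linear_cmul[OF U] algebra_simps)
    moreover have "c * c' > 0" "orthogonal_transformation (U \<circ> U')"
      using A B by (simp_all add: orthogonal_transformation_compose)
    ultimately show ?case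
      by blast
  next
    case (inverse A)
    then obtain c U b where A: "A = (\<lambda>x. c *\<^sub>R U x + b)" "c > 0" "orthogonal_transformation U"
      by blast
    have iU: "orthogonal_transformation (inv U)"
      using A(3) by (rule orthogonal_transformation_inv)
    then have lin: "linear (inv U)"
      by (simp add: orthogonal_transformation)
    have U: "inv U (U x) = x" "U (inv U x) = x" for x
      using orthogonal_transformation_bij[OF A(3)]
      by (simp_all add: bij_is_inj bij_is_surj surj_f_inv_f)
    have "linear U"
      using A(3) by (simp add: orthogonal_transformation)
    then have "inv A = (\<lambda>x. (1 / c) *\<^sub>R inv U x + - ((1 / c) *\<^sub>R inv U b))"
      using A(2) unfolding A(1)
      by (intro inv_equality)
        (simp_all add: linear_add linear_diff linear_cmul lin U
          linear_neg algebra_simps)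
    moreover have "1 / c > 0"
      using A(2) by simp
    ultimately show ?case
      using iU by blast
  qed
next
  fix A :: "real ^ 'n \<Rightarrow> real ^ 'n"
  assume "A \<in> ?S"
  then obtain c U b where A: "A = (\<lambda>x. c *\<^sub>R U x + b)" "c > 0" "orthogonal_transformation U"
    by blast
  have "(\<lambda>x. c *\<^sub>R U x) \<in> similarities"
  proof (rule similarities.linear)
    show lin: "linear (\<lambda>x. c *\<^sub>R U x)"
      using A(3) by (simp add: orthogonal_transformation linear_compose_scale_right)
    have "inj (\<lambda>x. c *\<^sub>R U x)"
      using A(2) orthogonal_transformation_inj[OF A(3)] by (simp add: inj_def)
    then show "bij (\<lambda>x. c *\<^sub>R U x)"
      using lin linear_injective_imp_surjective by (auto simp: bij_def)
    show "orthogonal (c *\<^sub>R U x) (c *\<^sub>R U y)" if "orthogonal x y" for x y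
      using that A(3) by (simp add: orthogonal_def orthogonal_transformation_def)
  qed
  from similarities.comp[OF similarities.shift[of b] this] show "A \<in> similarities"
    by (simp add: A(1) comp_def)
qed

end

theory Submission
  imports Defs
begin

text \<open>
  The squared distance to a point is uniformly convex, so a supremum of functions
  \<open>y \<mapsto> |y - a\<^sub>i|\<^sup>2 - k\<^sub>i\<close> has a unique minimizer, which depends continuously and equivariantly on
  the data. Such minimizers replace integration over the group. With \<open>a\<close> ranging over \<open>K\<close> and
  \<open>k = 0\<close> this gives the centre and the radius of the smallest ball containing \<open>K\<close>; normalizing by
  them reduces similarities to orthogonal transformations. Let \<open>B\<close> and \<open>v\<close> be the normalizations of
  \<open>K0\<close> and \<open>x0\<close>. As the orthogonal group is compact and the stabilizer of \<open>B\<close> fixes \<open>v\<close>, the map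
  \<open>g ` B \<mapsto> g v\<close> has a subadditive modulus of continuity \<open>m\<close>. The minimizer of
  \<open>y \<mapsto> sup\<^sub>g (|y - g v|\<^sup>2 - m (d(K, g ` B)))\<close> is an equivariant continuous function of the normalized
  body \<open>K\<close>, and its value at \<open>B\<close> is \<open>v\<close>, because there every term is nonpositive at \<open>y = v\<close> while the
  term of the identity is \<open>|y - v|\<^sup>2\<close>. For a point of the body, compose with the nearest-point
  projection onto \<open>K\<close>.
\<close>

section \<open>Minimizers of suprema of squared distances\<close>

text \<open>Only midpoints are tested, with the constant for which the squared distance to a point
  gives equality. A supremum inherits the inequality from its terms.\<close>

definition strongly_convex :: "('a::euclidean_space \<Rightarrow> real) \<Rightarrow> bool" where
  "strongly_convex F \<longleftrightarrow>
    (\<forall>x y. F (midpoint x y) \<le> (F x + F y) / 2 - (dist x y)\<^sup>2 / 4)"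

text \<open>The description is meaningful only when exactly one minimum point exists. Strong
  convexity gives uniqueness, and existence is proved for envelopes in
  \<open>envelope_attains_inf\<close>.\<close>

definition minimizer :: "('a \<Rightarrow> real) \<Rightarrow> 'a" where
  "minimizer F = (THE x. \<forall>y. F x \<le> F y)"

text \<open>This is the parallelogram law for the vectors \<open>x - z\<close> and
  \<open>y - z\<close>.\<close>

lemma dist_midpoint_square:
  fixes x y z :: "'a::real_inner"
  shows "(dist (midpoint x y) z)\<^sup>2 = ((dist x z)\<^sup>2 + (dist y z)\<^sup>2) / 2 - (dist x y)\<^sup>2 / 4"
proof -
  have "midpoint x y - z = (1 / 2) *\<^sub>R ((x - z) + (y - z))" "x - y = (x - z) - (y - z)"
    by (simp_all add: midpoint_def algebra_simps flip: scaleR_add_left)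
  then show ?thesis
    unfolding dist_norm power2_norm_eq_inner
    by (simp only: inner_add_left inner_add_right inner_diff_left inner_diff_right
        inner_scaleR_left inner_scaleR_right inner_commute[of "y - z" "x - z"]) argo
qed

text \<open>Compare the minimum with the value at the midpoint of \<open>x\<close> and
  \<open>y\<close>. The estimate yields uniqueness of the minimizer, and it is also the source of
  every continuity bound for minimizers below: a point whose value is nearly minimal is near the
  minimizer.\<close>

lemma strongly_convex_growth:
  assumes "strongly_convex F" "\<And>z. F x \<le> F z"
  shows "(dist x y)\<^sup>2 \<le> 2 * (F y - F x)"
proof -
  have "F x \<le> (F x + F y) / 2 - (dist x y)\<^sup>2 / 4"
    using assms order_trans unfolding strongly_convex_def by blast
  then show ?thesis
    by argo
qed

lemma minimizer_eqI:
  assumes "strongly_convex F" "\<And>z. F x \<le> F z"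
  shows "minimizer F = x"
  unfolding minimizer_def
proof (rule the_equality)
  show "y = x" if "\<forall>z. F y \<le> F z" for y
  proof -
    have "(dist x y)\<^sup>2 \<le> 0"
      using strongly_convex_growth[OF assms, of y] that[rule_format, of x] by argo
    then show ?thesis
      by simp
  qed
qed (use assms in blast)

lemma minimizer_compose:
  assumes F: "strongly_convex F" "\<And>z. F x \<le> F z" and G: "strongly_convex G"
    and "surj A" "c > 0" "\<And>y. G (A y) = c * F y"
  shows "minimizer G = A (minimizer F)"
proof (rule minimizer_eqI[OF G])
  fix z
  obtain y where "z = A y"
    using \<open>surj A\<close> by blast
  then show "G (A (minimizer F)) \<le> G z"
    using assms minimizer_eqI[OF F] by simp
qed

definition envelope :: "'i set \<Rightarrow> ('i \<Rightarrow> 'a::euclidean_space) \<Rightarrow> ('i \<Rightarrow> real) \<Rightarrow> 'a \<Rightarrow> real" where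
  "envelope I a k y = (SUP i\<in>I. (dist y (a i))\<^sup>2 - k i)"

text \<open>These conditions make the real supremum in \<open>envelope\<close> a genuine least upper
  bound at every point; on empty or unbounded sets \<open>SUP\<close> carries no
  information.\<close>

locale bounded_family =
  fixes I :: "'i set" and a :: "'i \<Rightarrow> 'a::euclidean_space" and k :: "'i \<Rightarrow> real"
  assumes nonempty: "I \<noteq> {}" and bounded_a: "bounded (a ` I)" and bounded_k: "bounded (k ` I)"
begin

lemma bdd_above_envelope: "bdd_above ((\<lambda>i. (dist y (a i))\<^sup>2 - k i) ` I)"
proof -
  obtain e where e: "\<And>i. i \<in> I \<Longrightarrow> dist y (a i) \<le> e"
    using bounded_a by (auto simp: bounded_any_center[where a = y])
  obtain M where M: "\<And>i. i \<in> I \<Longrightarrow> \<bar>k i\<bar> \<le> M"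
    using bounded_k by (auto simp: bounded_iff)
  show ?thesis
  proof (rule bdd_aboveI2)
    fix i assume i: "i \<in> I"
    show "(dist y (a i))\<^sup>2 - k i \<le> e\<^sup>2 + M"
      using M[OF i] power_mono[OF e[OF i], of 2] by simp
  qed
qed

lemma envelope_upper: "i \<in> I \<Longrightarrow> (dist y (a i))\<^sup>2 - k i \<le> envelope I a k y"
  unfolding envelope_def by (rule cSUP_upper[OF _ bdd_above_envelope])

lemma envelope_least: "(\<And>i. i \<in> I \<Longrightarrow> (dist y (a i))\<^sup>2 - k i \<le> r) \<Longrightarrow> envelope I a k y \<le> r"
  unfolding envelope_def by (rule cSUP_least[OF nonempty])

lemma envelope_le_iff: "envelope I a k y \<le> r \<longleftrightarrow> (\<forall>i\<in>I. (dist y (a i))\<^sup>2 - k i \<le> r)"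
  using envelope_upper envelope_least order_trans by meson

lemma strongly_convex_envelope: "strongly_convex (envelope I a k)"
  unfolding strongly_convex_def
proof (intro allI envelope_least)
  fix x y i assume "i \<in> I"
  then show "(dist (midpoint x y) (a i))\<^sup>2 - k i
      \<le> (envelope I a k x + envelope I a k y) / 2 - (dist x y)\<^sup>2 / 4"
    using envelope_upper[of i x] envelope_upper[of i y] dist_midpoint_square[of x y "a i"] by argo
qed

text \<open>Sublevel sets just above the infimum are closed, as intersections of sublevel sets of
  the continuous terms, and bounded, because a single term already grows without bound. They are
  nested nonempty compact sets, and a common point attains the infimum.\<close>

lemma envelope_attains_inf: "\<exists>x. \<forall>z. envelope I a k x \<le> envelope I a k z"
proof -
  let ?F = "envelope I a k"
  obtain i where i: "i \<in> I"
    using nonempty by blast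
  have lower: "(dist y (a i))\<^sup>2 - k i \<le> ?F y" for y
    using i by (rule envelope_upper)
  have bdd: "bdd_below (range ?F)"
  proof (rule bdd_belowI2)
    show "- k i \<le> ?F y" for y
      using lower[of y] zero_le_power2[of "dist y (a i)"] by linarith
  qed
  define s where "s = Inf (range ?F)"
  define S where "S n = {y. ?F y \<le> s + inverse (real (Suc n))}" for n
  have "closed (S n)" for n
  proof -
    have "S n = (\<Inter>i\<in>I. {y. (dist y (a i))\<^sup>2 - k i \<le> s + inverse (real (Suc n))})"
      by (auto simp: S_def envelope_le_iff)
    then show ?thesis
      by (auto intro!: closed_INT closed_Collect_le continuous_intros)
  qed
  moreover have "bounded (S n)" for n
  proof -
    have "dist (a i) y \<le> sqrt (s + inverse (real (Suc n)) + k i)" if "y \<in> S n" for y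
      using that lower[of y] by (intro real_le_rsqrt) (auto simp: S_def dist_commute)
    then show ?thesis
      unfolding bounded_def by blast
  qed
  ultimately have "compact (S n)" for n
    by (simp add: compact_eq_bounded_closed)
  moreover have "S n \<noteq> {}" for n
  proof -
    have "Inf (range ?F) < s + inverse (real (Suc n))"
      by (simp add: s_def)
    then obtain y where "?F y < s + inverse (real (Suc n))"
      using cInf_lessD[of "range ?F"] by blast
    then have "y \<in> S n"
      by (simp add: S_def)
    then show ?thesis
      by blast
  qed
  moreover have "S n \<subseteq> S m" if "m \<le> n" for m n
  proof -
    have "inverse (real (Suc n)) \<le> inverse (real (Suc m))"
      using that by (intro le_imp_inverse_le) auto
    then have "s + inverse (real (Suc n)) \<le> s + inverse (real (Suc m))"
      by simp
    then show ?thesis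
      unfolding S_def by (blast intro: order_trans)
  qed
  ultimately have "\<Inter>(range S) \<noteq> {}"
    by (rule compact_nest)
  then obtain x where x: "\<And>n. x \<in> S n"
    by blast
  have "?F x \<le> s"
  proof (rule LIMSEQ_le_const)
    show "(\<lambda>n. s + inverse (real (Suc n))) \<longlonglongrightarrow> s"
      using LIMSEQ_inverse_real_of_nat_add .
  qed (use x in \<open>auto simp: S_def\<close>)
  then show ?thesis
    using cInf_lower[OF _ bdd] unfolding s_def by (meson order_trans rangeI)
qed

lemma minimizer_envelope_le: "envelope I a k (minimizer (envelope I a k)) \<le> envelope I a k z"
  using envelope_attains_inf minimizer_eqI[OF strongly_convex_envelope] by metis

lemmas dist_minimizer_envelope =
  strongly_convex_growth[OF strongly_convex_envelope minimizer_envelope_le]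

end

text \<open>Reindexing by \<open>\<phi>\<close> matches each point \<open>a i\<close> with its image under a similarity \<open>A\<close> of
  ratio \<open>c\<close>.\<close>

lemma
  assumes "bounded_family I a k" "bounded_family J b l"
    and \<phi>: "\<phi> ` I = J" "\<And>i. i \<in> I \<Longrightarrow> b (\<phi> i) = A (a i)" "\<And>i. i \<in> I \<Longrightarrow> l (\<phi> i) = c\<^sup>2 * k i"
    and A: "surj A" "c > 0" "\<And>x y. dist (A x) (A y) = c * dist x y"
  shows envelope_similarity: "envelope J b l (A y) = c\<^sup>2 * envelope I a k y"
    and minimizer_envelope_similarity:
      "minimizer (envelope J b l) = A (minimizer (envelope I a k))"
proof -
  interpret I: bounded_family I a k by fact
  interpret J: bounded_family J b l by fact
  show eq: "envelope J b l (A y) = c\<^sup>2 * envelope I a k y" for y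
  proof (rule eq_iff[THEN iffD2, OF conjI])
    have val: "(dist (A y) (b (\<phi> i)))\<^sup>2 - l (\<phi> i) = c\<^sup>2 * ((dist y (a i))\<^sup>2 - k i)"
      if "i \<in> I" for i
      using that \<phi> A by (simp add: power_mult_distrib algebra_simps)
    show "envelope J b l (A y) \<le> c\<^sup>2 * envelope I a k y"
      using val I.envelope_upper \<phi>(1) by (intro J.envelope_least) (auto intro!: mult_left_mono)
    have "envelope I a k y \<le> envelope J b l (A y) / c\<^sup>2"
    proof (rule I.envelope_least)
      fix i assume i: "i \<in> I"
      then have "c\<^sup>2 * ((dist y (a i))\<^sup>2 - k i) \<le> envelope J b l (A y)"
        using J.envelope_upper[of "\<phi> i" "A y"] val \<phi>(1) by auto
      then show "(dist y (a i))\<^sup>2 - k i \<le> envelope J b l (A y) / c\<^sup>2"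
        using \<open>c > 0\<close> by (simp add: pos_le_divide_eq mult.commute)
    qed
    then show "c\<^sup>2 * envelope I a k y \<le> envelope J b l (A y)"
      using \<open>c > 0\<close> by (simp add: pos_le_divide_eq mult.commute)
  qed
  show "minimizer (envelope J b l) = A (minimizer (envelope I a k))"
    using I.strongly_convex_envelope I.minimizer_envelope_le J.strongly_convex_envelope A(1)
      zero_less_power[OF A(2)] eq
    by (rule minimizer_compose)
qed

section \<open>Hausdorff distance and similarities\<close>

lemma hausdorff_dist_leI:
  assumes "compact K" "compact L" "K \<noteq> {}" "L \<noteq> {}"
    and "\<And>x. x \<in> K \<Longrightarrow> \<exists>y\<in>L. dist x y \<le> r" "\<And>y. y \<in> L \<Longrightarrow> \<exists>x\<in>K. dist x y \<le> r"
  shows "hausdorff_dist K L \<le> r"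
proof (rule hausdorff_dist_le[OF assms(1-4)])
  show "infdist x L \<le> r" if "x \<in> K" for x
    using assms(5)[OF that] infdist_le2 by blast
  show "infdist y K \<le> r" if "y \<in> L" for y
    using assms(6)[OF that] infdist_le2 dist_commute by metis
qed

lemma hausdorff_dist_approx:
  fixes K L :: "'a::heine_borel set"
  assumes "compact K" "compact L" "K \<noteq> {}" "L \<noteq> {}" "x \<in> K"
  shows "\<exists>y\<in>L. dist x y \<le> hausdorff_dist K L"
proof -
  obtain y where "y \<in> L" "infdist x L = dist x y"
    using infdist_attains_inf[OF compact_imp_closed[OF assms(2)] assms(4), of x] by blast
  then show ?thesis
    using infdist_le_hausdorff_dist[OF assms] by auto
qed

lemma compact_linear_image:
  fixes f :: "'a::euclidean_space \<Rightarrow> 'b::real_normed_vector"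
  assumes "linear f" "compact S"
  shows "compact (f ` S)"
  using assms by (intro compact_continuous_image linear_continuous_on)
    (simp_all add: linear_conv_bounded_linear)

text \<open>Matching points stay matched under an isometry, so the distance does not increase. The
  same bound for the inverse transformation gives equality.\<close>

lemma hausdorff_dist_image_isometry:
  fixes f :: "real ^ 'n \<Rightarrow> real ^ 'n"
  assumes KL: "compact K" "compact L" "K \<noteq> {}" "L \<noteq> {}" and f: "orthogonal_transformation f"
  shows "hausdorff_dist (f ` K) (f ` L) = hausdorff_dist K L"
proof -
  have lin: "linear g" if "orthogonal_transformation g" for g :: "real ^ 'n \<Rightarrow> real ^ 'n"
    using that by (simp add: orthogonal_transformation)
  have iso: "dist (g x) (g y) = dist x y" if "orthogonal_transformation g"
    for g :: "real ^ 'n \<Rightarrow> real ^ 'n" and x y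
    using that by (simp add: orthogonal_transformation_isometry)
  have le: "hausdorff_dist (g ` A) (g ` B) \<le> hausdorff_dist A B"
    if g: "orthogonal_transformation g" and AB: "compact A" "compact B" "A \<noteq> {}" "B \<noteq> {}"
    for g :: "real ^ 'n \<Rightarrow> real ^ 'n" and A B
  proof (rule hausdorff_dist_leI)
    show "compact (g ` A)" "compact (g ` B)"
      using AB lin[OF g] by (simp_all add: compact_linear_image)
    show "\<exists>y\<in>g ` B. dist x y \<le> hausdorff_dist A B" if "x \<in> g ` A" for x
      using that hausdorff_dist_approx[OF AB] by (auto simp: iso[OF g])
    show "\<exists>x\<in>g ` A. dist x y \<le> hausdorff_dist A B" if "y \<in> g ` B" for y
      using that hausdorff_dist_approx[OF AB(2,1,4,3)]
      by (auto simp: iso[OF g] hausdorff_dist_commute[of B] dist_commute)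
  qed (use AB in auto)
  have inv: "inv f ` f ` S = S" for S
    using orthogonal_transformation_inj[OF f] by (simp add: image_image)
  have "hausdorff_dist K L \<le> hausdorff_dist (f ` K) (f ` L)"
    using le[OF orthogonal_transformation_inv[OF f], of "f ` K" "f ` L"] KL lin[OF f]
    by (simp add: inv compact_linear_image)
  then show ?thesis
    using le[OF f KL] by simp
qed

lemma similarityE:
  fixes A :: "real ^ 'n \<Rightarrow> real ^ 'n"
  assumes "A \<in> similarities"
  obtains c U b where "c > 0" "orthogonal_transformation U" "A = (\<lambda>x. c *\<^sub>R U x + b)"
    "\<And>x y. dist (A x) (A y) = c * dist x y" "surj A" "inj A"
proof -
  obtain c U b where A: "c > 0" "orthogonal_transformation U" "A = (\<lambda>x. c *\<^sub>R U x + b)"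
    using assms unfolding similarities_eq by blast
  have U: "dist (U x) (U y) = dist x y" for x y
    using A(2) by (simp add: orthogonal_transformation_isometry)
  have dist: "dist (A x) (A y) = c * dist x y" for x y
    using A(1) U[of x y] by (simp add: A(3) dist_norm flip: scaleR_diff_right)
  have "surj A"
  proof (rule surjI)
    show "A (inv U ((1 / c) *\<^sub>R (y - b))) = y" for y
      using A(1) orthogonal_transformation_surj[OF A(2)] by (simp add: A(3) surj_f_inv_f)
  qed
  moreover have "inj A"
    using dist A(1) by (metis dist_eq_0_iff injI mult_eq_0_iff less_irrefl)
  ultimately show ?thesis
    using that A dist by blast
qed

lemma image_similarity_convex_bodies:
  assumes "A \<in> similarities" "K \<in> convex_bodies"
  shows "A ` K \<in> convex_bodies"
proof -
  obtain c U b where A: "c > 0" "orthogonal_transformation U" "A = (\<lambda>x. c *\<^sub>R U x + b)"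
    using assms(1) by (rule similarityE)
  define f where "f = (\<lambda>x. c *\<^sub>R U x)"
  have f: "linear f" "inj f"
    using A orthogonal_transformation_inj[OF A(2)]
    by (simp_all add: f_def orthogonal_transformation linear_compose_scale_right inj_def)
  have "A ` K = (+) b ` (f ` K)"
    by (simp add: A(3) f_def image_image add.commute)
  moreover have "compact (f ` K)" "convex (f ` K)" "interior (f ` K) \<noteq> {}"
    using f convex_bodiesD[OF assms(2)]
    by (simp_all add: compact_linear_image convex_linear_image
        interior_injective_linear_image)
  ultimately show ?thesis
    by (simp add: convex_bodies_def compact_translation convex_translation interior_translation)
qed

lemma orthogonal_transformation_in_similarities:
  fixes U :: "real ^ 'n \<Rightarrow> real ^ 'n"
  assumes "orthogonal_transformation U"
  shows "U \<in> similarities"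
proof -
  have "U = (\<lambda>x. 1 *\<^sub>R U x + 0)" "(1::real) > 0"
    by simp_all
  then show ?thesis
    unfolding similarities_eq using assms by blast
qed

text \<open>The neighbourhoods of \<open>K\<close> in the Hausdorff metric are pulled back from 0
  along the distance to \<open>K\<close>. The topology of bodies is a value and not a type class
  instance; the filter makes the calculus of \<open>tendsto\<close> applicable to maps on
  bodies.\<close>

definition body_filter :: "(real ^ 'n) set \<Rightarrow> (real ^ 'n) set filter" where
  "body_filter K = inf (filtercomap (hausdorff_dist K) (nhds 0)) (principal convex_bodies)"

lemma eventually_body_filter: "eventually (\<lambda>L. L \<in> convex_bodies) (body_filter K)"
  by (auto simp: body_filter_def eventually_inf_principal)

lemma tendsto_hausdorff_dist: "(hausdorff_dist K \<longlongrightarrow> 0) (body_filter K)"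
  unfolding body_filter_def
  by (rule filterlim_mono[OF filterlim_filtercomap order_refl]) simp

lemma filterlim_body_filterI:
  assumes "((\<lambda>x. hausdorff_dist K (f x)) \<longlongrightarrow> 0) F" "\<forall>\<^sub>F x in F. f x \<in> convex_bodies"
  shows "filterlim f (body_filter K) F"
  using assms
  by (simp add: body_filter_def filterlim_inf filterlim_filtercomap_iff comp_def filterlim_principal)

lemma continuous_map_convex_body_topologyI:
  assumes "\<And>K. K \<in> convex_bodies \<Longrightarrow> (p \<longlongrightarrow> p K) (body_filter K)"
  shows "continuous_map convex_body_topology euclidean p"
proof -
  interpret Metric_space convex_bodies "hausdorff_dist :: (real ^ 'n) set \<Rightarrow> _"
    by (rule Metric_space_convex_bodies)
  have "openin mtopology {K \<in> convex_bodies. p K \<in> V}" if "open V" for V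
    unfolding openin_mtopology
  proof (intro conjI allI impI)
    fix K assume K: "K \<in> {K \<in> convex_bodies. p K \<in> V}"
    then have "\<forall>\<^sub>F L in body_filter K. p L \<in> V"
      using assms \<open>open V\<close> by (auto dest: topological_tendstoD)
    then obtain Q where "eventually Q (nhds 0)"
      and Q: "\<And>L. Q (hausdorff_dist K L) \<Longrightarrow> L \<in> convex_bodies \<Longrightarrow> p L \<in> V"
      unfolding body_filter_def eventually_inf_principal eventually_filtercomap by blast
    then obtain r where r: "r > 0" "\<And>t. dist t 0 < r \<Longrightarrow> Q t"
      unfolding eventually_nhds_metric by blast
    have "mball K r \<subseteq> {K \<in> convex_bodies. p K \<in> V}"
      using r(2) Q by (auto simp: dist_real_def)
    then show "\<exists>r>0. mball K r \<subseteq> {K \<in> convex_bodies. p K \<in> V}"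
      using r(1) by blast
  qed auto
  then show ?thesis
    by (simp add: continuous_map_def convex_body_topology_def)
qed

lemma hausdorff_dist_self:
  assumes "compact K" "K \<noteq> {}"
  shows "hausdorff_dist K K = 0"
  using hausdorff_dist_le[OF assms(1,1,2,2), of 0] hausdorff_dist_nonneg[of K K] by simp

lemma hausdorff_dist_triangle:
  fixes K L M :: "(real ^ 'n) set"
  assumes "K \<in> convex_bodies" "L \<in> convex_bodies" "M \<in> convex_bodies"
  shows "hausdorff_dist K M \<le> hausdorff_dist K L + hausdorff_dist L M"
  using Metric_space.triangle[OF Metric_space_convex_bodies assms] .

lemma image_orthogonal_convex_bodies:
  fixes U :: "real ^ 'n \<Rightarrow> real ^ 'n"
  shows "\<lbrakk>orthogonal_transformation U; K \<in> convex_bodies\<rbrakk> \<Longrightarrow> U ` K \<in> convex_bodies"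
  by (rule image_similarity_convex_bodies[OF orthogonal_transformation_in_similarities])

section \<open>Circumscribed balls and normalization\<close>

text \<open>The envelope with zero offsets is the square of the largest distance from
  \<open>y\<close> to a point of \<open>K\<close>. Its square carries the strong convexity, while
  the root satisfies the triangle inequalities used for Hausdorff estimates.\<close>

definition farthest :: "'a::euclidean_space set \<Rightarrow> 'a \<Rightarrow> real" where
  "farthest K y = sqrt (envelope K (\<lambda>x. x) (\<lambda>_. 0) y)"

definition circumcenter :: "'a::euclidean_space set \<Rightarrow> 'a" where
  "circumcenter K = minimizer (envelope K (\<lambda>x. x) (\<lambda>_. 0))"

definition circumradius :: "'a::euclidean_space set \<Rightarrow> real" where
  "circumradius K = farthest K (circumcenter K)"

lemma bounded_family_body:
  "K \<in> convex_bodies \<Longrightarrow> bounded_family K (\<lambda>x. x) (\<lambda>_. 0)"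
  by unfold_locales
    (auto dest: convex_bodiesD compact_imp_bounded simp: finite_imp_bounded image_constant_conv)

context
  fixes K :: "(real ^ 'n) set"
  assumes K: "K \<in> convex_bodies"
begin

interpretation bounded_family K "\<lambda>x. x" "\<lambda>_. 0"
  using K by (rule bounded_family_body)

lemma farthest_square: "(farthest K y)\<^sup>2 = envelope K (\<lambda>x. x) (\<lambda>_. 0) y"
proof -
  obtain x where "x \<in> K"
    using nonempty by blast
  then have "0 \<le> envelope K (\<lambda>x. x) (\<lambda>_. 0) y"
    using envelope_upper[of x y] zero_le_power2[of "dist y x"] by linarith
  then show ?thesis
    by (simp add: farthest_def)
qed

lemma dist_le_farthest: "x \<in> K \<Longrightarrow> dist y x \<le> farthest K y"
  unfolding farthest_def using envelope_upper[of x y] by (intro real_le_rsqrt) simp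

lemma farthest_nonneg: "0 \<le> farthest K y"
  using nonempty dist_le_farthest zero_le_dist order_trans by blast

lemma farthest_least:
  assumes "\<And>x. x \<in> K \<Longrightarrow> dist y x \<le> r"
  shows "farthest K y \<le> r"
proof -
  have "0 \<le> r"
    using nonempty assms zero_le_dist order_trans by blast
  moreover have "envelope K (\<lambda>x. x) (\<lambda>_. 0) y \<le> r\<^sup>2"
    using assms by (intro envelope_least) (simp add: power_mono)
  ultimately show ?thesis
    unfolding farthest_def by (rule real_le_lsqrt)
qed

lemma circumradius_le_farthest: "circumradius K \<le> farthest K y"
  unfolding circumradius_def farthest_def circumcenter_def
  by (rule real_sqrt_le_mono[OF minimizer_envelope_le])

lemma dist_circumcenter_square:
  "(dist (circumcenter K) y)\<^sup>2 \<le> 2 * ((farthest K y)\<^sup>2 - (circumradius K)\<^sup>2)"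
  using dist_minimizer_envelope[of y]
  by (simp only: farthest_square circumradius_def) (simp add: circumcenter_def)

text \<open>Non-empty interior enters here: with radius 0 the body would lie in a single point.
  Positivity permits division by the radius in \<open>normalization\<close>.\<close>

lemma circumradius_pos: "0 < circumradius K"
proof (rule ccontr)
  assume "\<not> 0 < circumradius K"
  then have "dist (circumcenter K) x \<le> 0" if "x \<in> K" for x
    using dist_le_farthest[OF that, of "circumcenter K"] unfolding circumradius_def by linarith
  then have "K \<subseteq> {circumcenter K}"
    by auto
  then have "interior K \<subseteq> interior {circumcenter K}"
    by (rule interior_mono)
  then show False
    using convex_bodiesD(3)[OF K] by simp
qed

lemma
  assumes A: "A \<in> similarities"
  shows circumcenter_similarity: "circumcenter (A ` K) = A (circumcenter K)"
    and circumradius_similarity: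
      "\<lbrakk>c > 0; \<And>x y. dist (A x) (A y) = c * dist x y\<rbrakk>
        \<Longrightarrow> circumradius (A ` K) = c * circumradius K"
proof -
  interpret AK: bounded_family "A ` K" "\<lambda>x. x" "\<lambda>_. 0"
    using image_similarity_convex_bodies[OF A K] by (rule bounded_family_body)
  have surj: "surj A"
    using A by (rule similarityE)
  show center: "circumcenter (A ` K) = A (circumcenter K)"
  proof -
    obtain c where c: "c > 0" "\<And>x y. dist (A x) (A y) = c * dist x y"
      using A by (rule similarityE) blast
    show ?thesis
      unfolding circumcenter_def
      by (rule minimizer_envelope_similarity[OF bounded_family_axioms AK.bounded_family_axioms,
            where \<phi> = A and c = c]) (simp_all add: surj c)
  qed
  show "circumradius (A ` K) = c * circumradius K"
    if c: "c > 0" "\<And>x y. dist (A x) (A y) = c * dist x y"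
  proof -
    have "envelope (A ` K) (\<lambda>x. x) (\<lambda>_. 0) (A (circumcenter K)) =
      c\<^sup>2 * envelope K (\<lambda>x. x) (\<lambda>_. 0) (circumcenter K)"
      by (rule envelope_similarity[OF bounded_family_axioms AK.bounded_family_axioms,
            where \<phi> = A]) (simp_all add: surj c)
    then show ?thesis
      using c(1) by (simp add: circumradius_def center farthest_def real_sqrt_mult)
  qed
qed

lemma farthest_hausdorff:
  assumes L: "L \<in> convex_bodies"
  shows "farthest K y \<le> farthest L y + hausdorff_dist K L"
proof (rule farthest_least)
  fix x assume "x \<in> K"
  then obtain x' where x': "x' \<in> L" "dist x x' \<le> hausdorff_dist K L"
    using hausdorff_dist_approx convex_bodiesD(1,4)[OF K] convex_bodiesD(1,4)[OF L] by metis
  interpret L: bounded_family L "\<lambda>x. x" "\<lambda>_. 0"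
    using L by (rule bounded_family_body)
  have "dist y x' \<le> farthest L y"
    unfolding farthest_def using L.envelope_upper[OF x'(1), of y] by (intro real_le_rsqrt) simp
  then show "dist y x \<le> farthest L y + hausdorff_dist K L"
    using x'(2) dist_triangle[of y x x'] by (simp add: dist_commute)
qed

end

context
  fixes K :: "(real ^ 'n) set"
  assumes K: "K \<in> convex_bodies"
begin

lemma circumradius_hausdorff:
  assumes L: "L \<in> convex_bodies"
  shows "\<bar>circumradius L - circumradius K\<bar> \<le> hausdorff_dist K L"
proof -
  have "circumradius M \<le> circumradius M' + hausdorff_dist M M'"
    if "M \<in> convex_bodies" "M' \<in> convex_bodies" for M M' :: "(real ^ 'n) set"
    using circumradius_le_farthest[OF that(1), of "circumcenter M'"]
      farthest_hausdorff[OF that, of "circumcenter M'"] by (simp add: circumradius_def)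
  from this[OF K L] this[OF L K] show ?thesis
    by (simp add: hausdorff_dist_commute[of L])
qed

text \<open>Let \<delta> be the Hausdorff distance. Passing from \<open>L\<close> to
  \<open>K\<close> costs \<delta> in the farthest distance, and the two circumradii differ by at
  most \<delta>. Hence the circumcenter of \<open>L\<close> misses the minimum for \<open>K\<close>
  by at most 2\<delta>, and the growth estimate bounds its squared distance from the circumcenter of
  \<open>K\<close>.\<close>

lemma circumcenter_hausdorff:
  assumes L: "L \<in> convex_bodies"
  shows "dist (circumcenter L) (circumcenter K) \<le>
    sqrt (2 * ((circumradius K + 2 * hausdorff_dist K L)\<^sup>2 - (circumradius K)\<^sup>2))"
proof (rule real_le_rsqrt)
  have "farthest K (circumcenter L) \<le> circumradius K + 2 * hausdorff_dist K L"
    using farthest_hausdorff[OF K L, of "circumcenter L"] circumradius_hausdorff[OF L]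
    by (simp add: circumradius_def)
  then have "(farthest K (circumcenter L))\<^sup>2 \<le> (circumradius K + 2 * hausdorff_dist K L)\<^sup>2"
    by (intro power_mono farthest_nonneg[OF K])
  then show "(dist (circumcenter L) (circumcenter K))\<^sup>2 \<le>
    2 * ((circumradius K + 2 * hausdorff_dist K L)\<^sup>2 - (circumradius K)\<^sup>2)"
    using dist_circumcenter_square[OF K, of "circumcenter L"] by (simp add: dist_commute)
qed

lemma tendsto_circumradius: "(circumradius \<longlongrightarrow> circumradius K) (body_filter K)"
proof (rule tendsto_dist_iff[THEN iffD2], rule tendsto_sandwich[where f = "\<lambda>_. 0"])
  show "\<forall>\<^sub>F L in body_filter K. dist (circumradius L) (circumradius K) \<le> hausdorff_dist K L"
    using eventually_body_filter
    by eventually_elim (simp add: dist_real_def circumradius_hausdorff)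
qed (auto intro: tendsto_hausdorff_dist)

lemma tendsto_circumcenter: "(circumcenter \<longlongrightarrow> circumcenter K) (body_filter K)"
proof (rule tendsto_dist_iff[THEN iffD2], rule tendsto_sandwich[where f = "\<lambda>_. 0"])
  let ?b = "\<lambda>t. sqrt (2 * ((circumradius K + 2 * t)\<^sup>2 - (circumradius K)\<^sup>2))"
  show "\<forall>\<^sub>F L in body_filter K.
      dist (circumcenter L) (circumcenter K) \<le> ?b (hausdorff_dist K L)"
    using eventually_body_filter by eventually_elim (rule circumcenter_hausdorff)
  have "((\<lambda>L. ?b (hausdorff_dist K L)) \<longlongrightarrow> ?b 0) (body_filter K)"
    by (intro tendsto_intros tendsto_hausdorff_dist)
  then show "((\<lambda>L. ?b (hausdorff_dist K L)) \<longlongrightarrow> 0) (body_filter K)"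
    by simp
qed auto

end

section \<open>Normalization of the circumscribed ball to the unit ball\<close>

definition normalization :: "(real ^ 'n) set \<Rightarrow> real ^ 'n \<Rightarrow> real ^ 'n" where
  "normalization K x = (1 / circumradius K) *\<^sub>R (x - circumcenter K)"

definition normalize_body :: "(real ^ 'n) set \<Rightarrow> (real ^ 'n) set" where
  "normalize_body K = normalization K ` K"

lemma normalization_similarity:
  assumes "K \<in> convex_bodies"
  shows "normalization K \<in> similarities"
proof -
  have "normalization K =
      (\<lambda>x. (1 / circumradius K) *\<^sub>R id x + (- (1 / circumradius K) *\<^sub>R circumcenter K))"
    by (simp add: normalization_def fun_eq_iff scaleR_diff_right)
  moreover have "1 / circumradius K > 0" "orthogonal_transformation (id :: real ^ 'n \<Rightarrow> _)"
    using circumradius_pos[OF assms] by (simp_all add: orthogonal_transformation_def linear_id)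
  ultimately show ?thesis
    unfolding similarities_eq by blast
qed

lemma normalize_body_convex_bodies:
  "K \<in> convex_bodies \<Longrightarrow> normalize_body K \<in> convex_bodies"
  unfolding normalize_body_def
  by (rule image_similarity_convex_bodies[OF normalization_similarity])

text \<open>The translation and the ratio of \<open>A\<close> cancel against the circumcenter and
  the circumradius, so only the orthogonal part survives. Thus a map equivariant under orthogonal
  transformations suffices on normalized bodies.\<close>

lemma normalize_body_similarity:
  assumes K: "K \<in> convex_bodies" and c: "c > 0" and U: "orthogonal_transformation U"
    and A: "A = (\<lambda>x. c *\<^sub>R U x + b)" "A \<in> similarities"
  shows "circumradius (A ` K) = c * circumradius K"
    and "normalize_body (A ` K) = U ` normalize_body K"
proof -
  have lin: "linear U"
    using U by (simp add: orthogonal_transformation)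
  have "dist (U x) (U y) = dist x y" for x y
    using U by (simp add: orthogonal_transformation_isometry)
  then have "dist (A x) (A y) = c * dist x y" for x y
    using c by (simp add: A(1) dist_norm flip: scaleR_diff_right)
  then show R: "circumradius (A ` K) = c * circumradius K"
    using circumradius_similarity[OF K A(2) c] by blast
  have "normalization (A ` K) (A x) = U (normalization K x)" for x
  proof -
    have "normalization (A ` K) (A x) =
        (1 / (c * circumradius K)) *\<^sub>R (A x - A (circumcenter K))"
      by (simp add: normalization_def circumcenter_similarity[OF K A(2)] R)
    also have "A x - A (circumcenter K) = c *\<^sub>R U (x - circumcenter K)"
      by (simp add: A(1) linear_diff[OF lin] scaleR_diff_right)
    finally show ?thesis
      using c by (simp add: normalization_def linear_cmul[OF lin])
  qed
  then show "normalize_body (A ` K) = U ` normalize_body K"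
    by (simp add: normalize_body_def image_image)
qed

lemma normalize_body_hausdorff:
  assumes K: "K \<in> convex_bodies" and L: "L \<in> convex_bodies"
  shows "hausdorff_dist (normalize_body K) (normalize_body L) \<le>
    (hausdorff_dist K L + dist (circumcenter L) (circumcenter K)) / circumradius L
    + \<bar>1 / circumradius K - 1 / circumradius L\<bar> * circumradius K" (is "_ \<le> ?r")
proof (rule hausdorff_dist_leI)
  note comp = convex_bodiesD(1,4)[OF K] convex_bodiesD(1,4)[OF L]
  have *: "dist (normalization K x) (normalization L y) \<le> ?r"
    if "x \<in> K" "dist x y \<le> hausdorff_dist K L" for x y
  proof -
    let ?c = "circumcenter K" and ?d = "circumcenter L"
      and ?a = "1 / circumradius K" and ?b = "1 / circumradius L"
    \<comment> \<open>The first summand comes from moving the point and the centre, the second from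
      changing the scale. In the second, \<open>x\<close> lies within \<open>circumradius K\<close>
      of the circumcenter of \<open>K\<close>.\<close>
    have "normalization K x - normalization L y =
        ?b *\<^sub>R ((x - y) + (?d - ?c)) + (?a - ?b) *\<^sub>R (x - ?c)"
      by (simp only: normalization_def scaleR_diff_left scaleR_diff_right scaleR_add_right) simp
    then have "dist (normalization K x) (normalization L y) \<le>
        norm (?b *\<^sub>R ((x - y) + (?d - ?c))) + norm ((?a - ?b) *\<^sub>R (x - ?c))"
      unfolding dist_norm by (metis norm_triangle_ineq)
    also have "norm (?b *\<^sub>R ((x - y) + (?d - ?c))) = ?b * norm ((x - y) + (?d - ?c))"
      using circumradius_pos[OF L] by simp
    also have "\<dots> \<le> ?b * (hausdorff_dist K L + dist ?d ?c)"
      using circumradius_pos[OF L] norm_triangle_ineq[of "x - y" "?d - ?c"] that(2)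
      by (intro mult_left_mono) (auto simp: dist_norm)
    also have "norm ((?a - ?b) *\<^sub>R (x - ?c)) \<le> \<bar>?a - ?b\<bar> * circumradius K"
      using dist_le_farthest[OF K that(1), of ?c]
      by (simp only: norm_scaleR, intro mult_left_mono)
        (simp_all add: circumradius_def dist_norm norm_minus_commute)
    finally show ?thesis
      by simp
  qed
  show "\<exists>y\<in>normalize_body L. dist x y \<le> ?r" if "x \<in> normalize_body K" for x
    using that * hausdorff_dist_approx[OF comp(1,3,2,4)]
    by (fastforce simp: normalize_body_def)
  show "\<exists>x\<in>normalize_body K. dist x y \<le> ?r" if y: "y \<in> normalize_body L" for y
  proof -
    obtain y' where y': "y' \<in> L" "y = normalization L y'"
      using y by (auto simp: normalize_body_def)
    obtain x' where x': "x' \<in> K" "dist y' x' \<le> hausdorff_dist L K"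
      using hausdorff_dist_approx[OF comp(3,1,4,2) y'(1)] by blast
    then have "dist x' y' \<le> hausdorff_dist K L"
      by (simp add: dist_commute hausdorff_dist_commute)
    then show ?thesis
      using *[OF x'(1)] x'(1) y'(2) by (auto simp: normalize_body_def)
  qed
qed (use K L normalize_body_convex_bodies convex_bodiesD in blast)+

lemma filterlim_normalize_body:
  assumes K: "K \<in> convex_bodies"
  shows "filterlim normalize_body (body_filter (normalize_body K)) (body_filter K)"
proof (rule filterlim_body_filterI, rule tendsto_sandwich[where f = "\<lambda>_. 0"])
  let ?r = "\<lambda>L. (hausdorff_dist K L + dist (circumcenter L) (circumcenter K)) / circumradius L
    + \<bar>1 / circumradius K - 1 / circumradius L\<bar> * circumradius K"
  show "\<forall>\<^sub>F L in body_filter K. hausdorff_dist (normalize_body K) (normalize_body L) \<le> ?r L"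
    using eventually_body_filter by eventually_elim (rule normalize_body_hausdorff[OF K])
  show "\<forall>\<^sub>F L in body_filter K. 0 \<le> hausdorff_dist (normalize_body K) (normalize_body L)"
    by (simp add: hausdorff_dist_nonneg)
  show "\<forall>\<^sub>F L in body_filter K. normalize_body L \<in> convex_bodies"
    using eventually_body_filter by eventually_elim (rule normalize_body_convex_bodies)
  have "(?r \<longlongrightarrow> (0 + dist (circumcenter K) (circumcenter K)) / circumradius K
      + \<bar>1 / circumradius K - 1 / circumradius K\<bar> * circumradius K) (body_filter K)"
    using circumradius_pos[OF K]
    by (intro tendsto_intros tendsto_hausdorff_dist tendsto_circumcenter[OF K]
        tendsto_circumradius[OF K]) simp_all
  then show "(?r \<longlongrightarrow> 0) (body_filter K)"
    by simp
qed simp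

section \<open>Equivariant extension from an orbit of the orthogonal group\<close>

text \<open>This is sequential compactness of the orthogonal group. As bounded operators its
  elements lie in the closed unit ball of a finite-dimensional space, and preservation of the norm
  passes to the limit.\<close>

lemma orthogonal_transformation_convergent_subsequence:
  fixes g :: "nat \<Rightarrow> 'a::euclidean_space \<Rightarrow> 'a"
  assumes g: "\<And>n. orthogonal_transformation (g n)"
  obtains U r where "orthogonal_transformation U" "strict_mono (r :: nat \<Rightarrow> nat)"
    "\<And>x. (\<lambda>n. g (r n) x) \<longlonglongrightarrow> U x"
proof -
  define G where "G n = Blinfun (g n)" for n
  have app: "blinfun_apply (G n) = g n" for n
    using g[of n] unfolding G_def
    by (intro bounded_linear_Blinfun_apply)
      (simp add: orthogonal_transformation linear_conv_bounded_linear)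
  have norm: "norm (g n x) = norm x" for n x
    using g by (simp add: orthogonal_transformation)
  have "norm (G n) \<le> 1" for n
    by (rule norm_blinfun_bound) (simp_all add: app norm)
  then have "\<forall>n. G n \<in> cball 0 1"
    by simp
  then obtain T r where r: "strict_mono (r :: nat \<Rightarrow> nat)" "(G \<circ> r) \<longlonglongrightarrow> T"
    using compact_cball[of "0 :: 'a \<Rightarrow>\<^sub>L 'a" 1] unfolding compact_def by blast
  have lim: "(\<lambda>n. g (r n) x) \<longlonglongrightarrow> blinfun_apply T x" for x
  proof -
    have "(\<lambda>n. blinfun_apply ((G \<circ> r) n) x) \<longlonglongrightarrow> blinfun_apply T x"
      by (intro tendsto_intros r)
    then show ?thesis
      by (simp add: app)
  qed
  have "norm (blinfun_apply T x) = norm x" for x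
    using tendsto_norm[OF lim[of x]] by (simp add: norm LIMSEQ_const_iff)
  then have "orthogonal_transformation (blinfun_apply T)"
    by (simp add: orthogonal_transformation bounded_linear.linear[OF blinfun.bounded_linear_right])
  then show ?thesis
    using that r(1) lim by blast
qed

lemma infdist_le_0_mem:
  fixes B :: "'a::heine_borel set"
  assumes "compact B" "B \<noteq> {}" "\<And>n. infdist (f n) B \<le> h n" "f \<longlonglongrightarrow> x" "h \<longlonglongrightarrow> 0"
  shows "x \<in> B"
proof -
  have "infdist x B \<le> 0"
    using assms(3) by (intro LIMSEQ_le[OF tendsto_infdist[OF assms(4)] assms(5)]) blast
  then have "infdist x B = 0"
    using infdist_nonneg[of x B] by simp
  then show ?thesis
    using in_closed_iff_infdist_zero[OF compact_imp_closed[OF assms(1)] assms(2)] by simp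
qed

lemma image_eq_of_tendsto:
  fixes B :: "'a::euclidean_space set"
  assumes B: "compact B" "B \<noteq> {}"
    and g: "\<And>n. orthogonal_transformation (g n)" and U: "orthogonal_transformation U"
    and lim: "\<And>x. (\<lambda>n. g n x) \<longlonglongrightarrow> U x" "(\<lambda>n. hausdorff_dist B (g n ` B)) \<longlonglongrightarrow> 0"
  shows "U ` B = B"
proof
  have iso: "dist (g n x) (g n y) = dist x y" for n x y
    using g[of n] by (simp add: orthogonal_transformation_isometry)
  have gB: "compact (g n ` B)" "g n ` B \<noteq> {}" for n
    using B g[of n] by (simp_all add: compact_linear_image orthogonal_transformation)
  show "U ` B \<subseteq> B"
  proof (rule image_subsetI)
    fix x assume "x \<in> B"
    then have "infdist (g n x) B \<le> hausdorff_dist B (g n ` B)" for n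
      using infdist_le_hausdorff_dist[OF gB(1) B(1) gB(2) B(2)]
      by (simp add: hausdorff_dist_commute[of B])
    then show "U x \<in> B"
      using lim by (rule infdist_le_0_mem[OF B])
  qed
  show "B \<subseteq> U ` B"
  proof
    fix x assume x: "x \<in> B"
    obtain w where w: "x = U w"
      using orthogonal_transformation_surj[OF U] by blast
    \<comment> \<open>The isometry \<open>g n\<close> carries the estimate back: \<open>w\<close> is
      as far from \<open>z\<close> as \<open>g n w\<close> is from \<open>g n z\<close>, while
      \<open>g n w\<close> tends to \<open>U w = x\<close> and \<open>g n z\<close> is close to
      \<open>x\<close>.\<close>
    have "infdist w B \<le> dist (g n w) x + hausdorff_dist B (g n ` B)" for n
    proof -
      obtain z where z: "z \<in> B" "dist x (g n z) \<le> hausdorff_dist B (g n ` B)"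
        using hausdorff_dist_approx[OF B(1) gB(1) B(2) gB(2) x] by blast
      have "dist w z \<le> dist (g n w) x + hausdorff_dist B (g n ` B)"
        using dist_triangle[of "g n w" "g n z" x] z(2) by (simp add: iso)
      then show ?thesis
        using infdist_le2[OF z(1)] by blast
    qed
    moreover have "(\<lambda>n. dist (g n w) x + hausdorff_dist B (g n ` B)) \<longlonglongrightarrow> 0"
      using tendsto_add[OF tendsto_dist[OF lim(1)[of w] tendsto_const[of x]] lim(2)] w by simp
    ultimately have "w \<in> B"
      using B by (intro infdist_le_0_mem[where f = "\<lambda>_. w"]) auto
    then show "x \<in> U ` B"
      using w by blast
  qed
qed

abbreviation orthogonal_group :: "('a::euclidean_space \<Rightarrow> 'a) set" where
  "orthogonal_group \<equiv> Collect orthogonal_transformation"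

lemma orthogonal_group_nonempty: "orthogonal_group \<noteq> {}"
  using orthogonal_transformation_id by (metis empty_iff mem_Collect_eq)

text \<open>The second assumption makes the map from the orbit of \<open>B\<close> to the orbit of
  \<open>v\<close> well defined: if \<open>g\<close> and \<open>h\<close> give the same image of
  \<open>B\<close>, then \<open>inv h \<circ> g\<close> stabilizes \<open>B\<close> and so fixes
  \<open>v\<close>.\<close>

locale stabilizer_fixed_point =
  fixes B :: "(real ^ 'n) set" and v :: "real ^ 'n"
  assumes body: "B \<in> convex_bodies"
    and fixed: "\<And>U. \<lbrakk>orthogonal_transformation U; U ` B = B\<rbrakk> \<Longrightarrow> U v = v"
begin

text \<open>Otherwise some transformations bring the image of \<open>B\<close> arbitrarily close to
  \<open>B\<close> while moving \<open>v\<close> by at least \<epsilon>. A convergent subsequence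
  has a limit that stabilizes \<open>B\<close> and therefore fixes \<open>v\<close>, a
  contradiction.\<close>

lemma displacement_small:
  assumes "\<epsilon> > 0"
  shows "\<exists>\<eta>>0. \<forall>g. orthogonal_transformation g \<longrightarrow> hausdorff_dist B (g ` B) < \<eta> \<longrightarrow>
    dist v (g v) < \<epsilon>"
proof (rule ccontr)
  assume "\<not> ?thesis"
  then have "\<exists>g. orthogonal_transformation g \<and> hausdorff_dist B (g ` B) < \<eta> \<and> \<epsilon> \<le> dist v (g v)"
    if "\<eta> > 0" for \<eta>
    using that not_less by metis
  then have "\<forall>n. \<exists>g. orthogonal_transformation g \<and>
      hausdorff_dist B (g ` B) < inverse (real (Suc n)) \<and> \<epsilon> \<le> dist v (g v)"
    by simp
  then obtain g where g: "\<And>n. orthogonal_transformation (g n)"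
    "\<And>n. hausdorff_dist B (g n ` B) < inverse (real (Suc n))" "\<And>n. \<epsilon> \<le> dist v (g n v)"
    by metis
  obtain U r where U: "orthogonal_transformation U" and r: "strict_mono (r :: nat \<Rightarrow> nat)"
    and lim: "\<And>x. (\<lambda>n. g (r n) x) \<longlonglongrightarrow> U x"
    using orthogonal_transformation_convergent_subsequence g(1) by metis
  have "(\<lambda>n. hausdorff_dist B (g n ` B)) \<longlonglongrightarrow> 0"
    by (rule tendsto_sandwich[OF _ _ tendsto_const LIMSEQ_inverse_real_of_nat])
      (use g(2) in \<open>simp_all add: hausdorff_dist_nonneg less_imp_le del: of_nat_Suc\<close>)
  then have "(\<lambda>n. hausdorff_dist B (g (r n) ` B)) \<longlonglongrightarrow> 0"
    using LIMSEQ_subseq_LIMSEQ[OF _ r] by (fastforce simp: comp_def)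
  then have "U ` B = B"
    using g(1) U lim convex_bodiesD(1,4)[OF body] by (intro image_eq_of_tendsto)
  then have "(\<lambda>n. dist v (g (r n) v)) \<longlonglongrightarrow> dist v v"
    using tendsto_dist[OF tendsto_const lim[of v], of v] fixed[OF U] by simp
  then have "\<epsilon> \<le> dist v v"
    by (rule LIMSEQ_le_const) (use g(3) in blast)
  then show False
    using \<open>\<epsilon> > 0\<close> by simp
qed

text \<open>A modulus for the map \<open>g ` B \<mapsto> g v\<close>. The factor is \<open>0\<close> when \<open>g ` B = B\<close>, since the
  quotient is then \<open>t / 0\<close>; this is harmless because such \<open>g\<close> fix \<open>v\<close>.\<close>

definition modulus_term :: "real \<Rightarrow> (real ^ 'n \<Rightarrow> real ^ 'n) \<Rightarrow> real" where
  "modulus_term t g = (dist v (g v))\<^sup>2 * min 1 (t / hausdorff_dist B (g ` B))"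

text \<open>At a nonzero Hausdorff distance between \<open>B\<close> and its image under
  \<open>g\<close>, the term of \<open>g\<close> is the full squared displacement, so the supremum
  dominates it. The cap 1 in each term keeps the supremum bounded, as \<open>bounded_family\<close>
  requires of the offsets.\<close>

definition modulus :: "real \<Rightarrow> real" where
  "modulus t = (SUP g\<in>orthogonal_group. modulus_term t g)"

lemma norm_image: "orthogonal_transformation g \<Longrightarrow> norm (g v) = norm v"
  by (simp add: orthogonal_transformation)

lemma displacement_le:
  assumes "orthogonal_transformation g"
  shows "(dist v (g v))\<^sup>2 \<le> (2 * norm v)\<^sup>2"
proof (rule power_mono)
  show "dist v (g v) \<le> 2 * norm v"
    using norm_triangle_ineq4[of v "g v"] norm_image[OF assms] by (simp add: dist_norm)
qed simp

lemma modulus_term_nonneg: "0 \<le> t \<Longrightarrow> 0 \<le> modulus_term t g"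
  by (simp add: modulus_term_def hausdorff_dist_nonneg)

lemma modulus_term_le: "modulus_term t g \<le> (dist v (g v))\<^sup>2"
  unfolding modulus_term_def by (rule mult_left_le) auto

lemma bdd_above_modulus:
  "bdd_above (modulus_term t ` orthogonal_group)"
  using modulus_term_le displacement_le order_trans by (intro bdd_aboveI2) blast

lemma modulus_upper: "orthogonal_transformation g \<Longrightarrow> modulus_term t g \<le> modulus t"
  unfolding modulus_def by (rule cSUP_upper[OF _ bdd_above_modulus]) simp

lemma modulus_least:
  "(\<And>g. orthogonal_transformation g \<Longrightarrow> modulus_term t g \<le> r) \<Longrightarrow> modulus t \<le> r"
  unfolding modulus_def by (rule cSUP_least[OF orthogonal_group_nonempty]) simp

lemma modulus_nonneg: "0 \<le> t \<Longrightarrow> 0 \<le> modulus t"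
  using modulus_upper[OF orthogonal_transformation_id] modulus_term_nonneg order_trans by blast

lemma modulus_le: "modulus t \<le> (2 * norm v)\<^sup>2"
  using modulus_term_le displacement_le order_trans by (intro modulus_least) blast

lemma modulus_0: "modulus 0 = 0"
  using modulus_least[of 0 0] modulus_nonneg[of 0] by (simp add: modulus_term_def)

text \<open>A linear function capped at 1 is subadditive on nonnegative arguments, and this passes
  to the supremum. The form with \<open>s \<le> t + u\<close> also contains monotonicity, by taking
  \<open>u = 0\<close>.\<close>

lemma modulus_subadditive:
  assumes "0 \<le> t" "0 \<le> u" "s \<le> t + u"
  shows "modulus s \<le> modulus t + modulus u"
proof (rule modulus_least)
  fix g :: "real ^ 'n \<Rightarrow> real ^ 'n" assume g: "orthogonal_transformation g"
  let ?d = "hausdorff_dist B (g ` B)"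
  have "s / ?d \<le> t / ?d + u / ?d" "0 \<le> t / ?d" "0 \<le> u / ?d"
    using assms hausdorff_dist_nonneg[of B "g ` B"]
    by (simp_all add: divide_right_mono flip: add_divide_distrib)
  then have "min 1 (s / ?d) \<le> min 1 (t / ?d) + min 1 (u / ?d)"
    by linarith
  then have "modulus_term s g \<le> modulus_term t g + modulus_term u g"
    unfolding modulus_term_def distrib_left[symmetric] by (rule mult_left_mono) simp
  then show "modulus_term s g \<le> modulus t + modulus u"
    using modulus_upper[OF g, of t] modulus_upper[OF g, of u] by linarith
qed

lemma displacement_le_modulus:
  assumes g: "orthogonal_transformation g"
  shows "(dist v (g v))\<^sup>2 \<le> modulus (hausdorff_dist B (g ` B))"
proof (cases "hausdorff_dist B (g ` B) = 0")
  case True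
  then have "g ` B = B"
    using Metric_space.zero[OF Metric_space_convex_bodies body
        image_orthogonal_convex_bodies[OF g body]] by simp
  then show ?thesis
    using fixed[OF g] modulus_nonneg[OF hausdorff_dist_nonneg] by simp
next
  case False
  then show ?thesis
    using modulus_upper[OF g, of "hausdorff_dist B (g ` B)"] by (simp add: modulus_term_def)
qed

text \<open>Transformations that move \<open>B\<close> by less than \<eta> displace \<open>v\<close>
  by less than the root of \<epsilon>, whatever \<open>t\<close> is. For all others the quotient is
  at most \<open>t / \<eta>\<close>, which is small with \<open>t\<close>.\<close>

lemma modulus_small:
  assumes "\<epsilon> > 0"
  obtains \<delta> where "\<delta> > 0" "\<And>t. \<lbrakk>0 \<le> t; t < \<delta>\<rbrakk> \<Longrightarrow> modulus t \<le> \<epsilon>"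
proof -
  obtain \<eta> where "\<eta> > 0" and \<eta>: "\<And>g. \<lbrakk>orthogonal_transformation g; hausdorff_dist B (g ` B) < \<eta>\<rbrakk>
      \<Longrightarrow> dist v (g v) < sqrt \<epsilon>"
    using displacement_small[of "sqrt \<epsilon>"] assms by (metis real_sqrt_gt_zero)
  \<comment> \<open>The summand 1 keeps \<open>C\<close> positive when \<open>v = 0\<close>, so that
    division by \<open>C\<close> is sound.\<close>
  define C where "C = (2 * norm v)\<^sup>2 + 1"
  have "C > 0"
    by (simp add: C_def add_nonneg_pos)
  have "modulus t \<le> \<epsilon>" if t: "0 \<le> t" "t < \<epsilon> * \<eta> / C" for t
  proof (rule modulus_least)
    fix g :: "real ^ 'n \<Rightarrow> real ^ 'n" assume g: "orthogonal_transformation g"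
    show "modulus_term t g \<le> \<epsilon>"
    proof (cases "hausdorff_dist B (g ` B) < \<eta>")
      case True
      then have "(dist v (g v))\<^sup>2 \<le> (sqrt \<epsilon>)\<^sup>2"
        using \<eta>[OF g] by (intro power_mono) auto
      then show ?thesis
        using modulus_term_le[of t g] assms by simp
    next
      case False
      have "modulus_term t g \<le> C * (t / \<eta>)"
        unfolding modulus_term_def
      proof (rule mult_mono)
        show "(dist v (g v))\<^sup>2 \<le> C"
          using displacement_le[OF g] by (simp add: C_def)
        have "t / hausdorff_dist B (g ` B) \<le> t / \<eta>"
          using False t(1) \<open>\<eta> > 0\<close> by (intro divide_left_mono) auto
        then show "min 1 (t / hausdorff_dist B (g ` B)) \<le> t / \<eta>"
          by simp
      qed (use \<open>C > 0\<close> t(1) in \<open>simp_all add: hausdorff_dist_nonneg\<close>)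
      also have "\<dots> \<le> \<epsilon>"
        using t(2) \<open>C > 0\<close> \<open>\<eta> > 0\<close> by (simp add: field_simps)
      finally show ?thesis .
    qed
  qed
  moreover have "\<epsilon> * \<eta> / C > 0"
    using assms \<open>\<eta> > 0\<close> \<open>C > 0\<close> by simp
  ultimately show ?thesis
    using that by blast
qed

lemma tendsto_modulus:
  assumes "(h \<longlongrightarrow> 0) F" "\<And>x. 0 \<le> h x"
  shows "((\<lambda>x. modulus (h x)) \<longlongrightarrow> 0) F"
proof (rule tendstoI)
  fix e :: real assume "e > 0"
  then obtain \<delta> where \<delta>: "\<delta> > 0" "\<And>t. \<lbrakk>0 \<le> t; t < \<delta>\<rbrakk> \<Longrightarrow> modulus t \<le> e / 2"
    using modulus_small[of "e / 2"] by auto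
  show "\<forall>\<^sub>F x in F. dist (modulus (h x)) 0 < e"
    using order_tendstoD(2)[OF assms(1) \<delta>(1)]
  proof eventually_elim
    case (elim x)
    then show ?case
      using \<delta>(2)[OF assms(2) elim] modulus_nonneg[OF assms(2), of x] \<open>e > 0\<close> by simp
  qed
qed

section \<open>The extension as a minimizer over the group\<close>

definition orbit_envelope :: "(real ^ 'n) set \<Rightarrow> real ^ 'n \<Rightarrow> real" where
  "orbit_envelope K = envelope (orthogonal_group) (\<lambda>g. g v)
    (\<lambda>g. modulus (hausdorff_dist K (g ` B)))"

definition orbit_extension :: "(real ^ 'n) set \<Rightarrow> real ^ 'n" where
  "orbit_extension K = minimizer (orbit_envelope K)"

lemma bounded_family_orbit:
  "bounded_family (orthogonal_group) (\<lambda>g. g v)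
    (\<lambda>g. modulus (hausdorff_dist K (g ` B)))"
proof
  show "orthogonal_group \<noteq> {}"
    by (rule orthogonal_group_nonempty)
  show "bounded ((\<lambda>g. g v) ` orthogonal_group)"
    by (rule boundedI[where B = "norm v"]) (auto simp: norm_image)
  have "norm (modulus (hausdorff_dist K (g ` B))) \<le> (2 * norm v)\<^sup>2" for g
    unfolding real_norm_def abs_of_nonneg[OF modulus_nonneg[OF hausdorff_dist_nonneg]]
    by (rule modulus_le)
  then show "bounded ((\<lambda>g. modulus (hausdorff_dist K (g ` B))) ` orthogonal_group)"
    unfolding bounded_iff by blast
qed

lemmas orbit_envelope_upper =
    bounded_family.envelope_upper[OF bounded_family_orbit, folded orbit_envelope_def, simplified]
  and orbit_envelope_least =
    bounded_family.envelope_least[OF bounded_family_orbit, folded orbit_envelope_def, simplified]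
  and strongly_convex_orbit_envelope =
    bounded_family.strongly_convex_envelope[OF bounded_family_orbit, folded orbit_envelope_def]
  and dist_orbit_extension = bounded_family.dist_minimizer_envelope[OF bounded_family_orbit,
      folded orbit_envelope_def, folded orbit_extension_def]
  and orbit_extension_le = bounded_family.minimizer_envelope_le[OF bounded_family_orbit,
      folded orbit_envelope_def, folded orbit_extension_def]

lemma orbit_extension_base: "orbit_extension B = v"
  unfolding orbit_extension_def
proof (rule minimizer_eqI[OF strongly_convex_orbit_envelope])
  fix z
  have "orbit_envelope B v \<le> 0"
    using displacement_le_modulus by (intro orbit_envelope_least) simp
  also have "0 \<le> (dist z v)\<^sup>2"
    by simp
  also have "\<dots> \<le> orbit_envelope B z"
    using orbit_envelope_upper[OF orthogonal_transformation_id, of z B]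
      convex_bodiesD(1,4)[OF body] by (simp add: hausdorff_dist_self modulus_0)
  finally show "orbit_envelope B v \<le> orbit_envelope B z" .
qed

text \<open>Left multiplication by \<open>U\<close> permutes the group. Reindexing by it turns the
  envelope of the image of \<open>K\<close> into the envelope of \<open>K\<close> transported by
  \<open>U\<close>, since Hausdorff distances are invariant under \<open>U\<close>.\<close>

lemma orbit_extension_equivariant:
  assumes U: "orthogonal_transformation U" and K: "K \<in> convex_bodies"
  shows "orbit_extension (U ` K) = U (orbit_extension K)"
  unfolding orbit_extension_def orbit_envelope_def
proof (rule minimizer_envelope_similarity[OF bounded_family_orbit bounded_family_orbit,
      where \<phi> = "(\<circ>) U" and c = 1])
  show "(\<circ>) U ` orthogonal_group = orthogonal_group"
  proof (intro equalityI subsetI)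
    fix g :: "real ^ 'n \<Rightarrow> real ^ 'n" assume "g \<in> orthogonal_group"
    then have "orthogonal_transformation (inv U \<circ> g)"
      using U by (simp add: orthogonal_transformation_compose orthogonal_transformation_inv)
    moreover have "g = U \<circ> (inv U \<circ> g)"
      using orthogonal_transformation_surj[OF U] by (simp add: fun_eq_iff surj_f_inv_f)
    ultimately show "g \<in> (\<circ>) U ` orthogonal_group"
      by blast
  qed (use U orthogonal_transformation_compose in auto)
  show "modulus (hausdorff_dist (U ` K) ((U \<circ> g) ` B)) = 1\<^sup>2 * modulus (hausdorff_dist K (g ` B))"
    if "g \<in> orthogonal_group" for g
    using that hausdorff_dist_image_isometry[OF _ _ _ _ U, of K "g ` B"]
      convex_bodiesD[OF K] convex_bodiesD[OF image_orthogonal_convex_bodies[OF _ body], of g]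
    by (simp add: image_comp)
qed (use U in \<open>simp_all add: orthogonal_transformation_surj orthogonal_transformation_isometry\<close>)

text \<open>Subadditivity of the modulus and the triangle inequality bound the difference of the two
  envelopes by the modulus of the distance, uniformly in the point. The minimizer for
  \<open>L\<close> is then within twice that of the minimum for \<open>K\<close>, and the growth
  estimate doubles the bound again.\<close>

lemma orbit_extension_hausdorff:
  assumes K: "K \<in> convex_bodies" and L: "L \<in> convex_bodies"
  shows "(dist (orbit_extension L) (orbit_extension K))\<^sup>2 \<le> 4 * modulus (hausdorff_dist K L)"
proof -
  have le: "orbit_envelope M z \<le> orbit_envelope M' z + modulus (hausdorff_dist M M')"
    if M: "M \<in> convex_bodies" "M' \<in> convex_bodies" for M M' z
  proof (rule orbit_envelope_least)
    fix g :: "real ^ 'n \<Rightarrow> real ^ 'n" assume g: "orthogonal_transformation g"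
    have "modulus (hausdorff_dist M' (g ` B)) \<le>
        modulus (hausdorff_dist M M') + modulus (hausdorff_dist M (g ` B))"
      using hausdorff_dist_triangle[OF M(2,1) image_orthogonal_convex_bodies[OF g body]]
      by (intro modulus_subadditive hausdorff_dist_nonneg) (simp add: hausdorff_dist_commute[of M'])
    then show "(dist z (g v))\<^sup>2 - modulus (hausdorff_dist M (g ` B))
        \<le> orbit_envelope M' z + modulus (hausdorff_dist M M')"
      using orbit_envelope_upper[OF g, of z M'] by linarith
  qed
  have "(dist (orbit_extension K) (orbit_extension L))\<^sup>2 \<le>
      2 * (orbit_envelope K (orbit_extension L) - orbit_envelope K (orbit_extension K))"
    by (rule dist_orbit_extension)
  moreover have "orbit_envelope L (orbit_extension L) \<le> orbit_envelope L (orbit_extension K)"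
    by (rule orbit_extension_le)
  ultimately show ?thesis
    using le[OF K L, of "orbit_extension L"] le[OF L K, of "orbit_extension K"]
    by (simp add: dist_commute hausdorff_dist_commute[of L])
qed

lemma tendsto_orbit_extension:
  assumes K: "K \<in> convex_bodies"
  shows "(orbit_extension \<longlongrightarrow> orbit_extension K) (body_filter K)"
proof (rule tendsto_dist_iff[THEN iffD2], rule tendsto_sandwich[where f = "\<lambda>_. 0"])
  show "\<forall>\<^sub>F L in body_filter K. dist (orbit_extension L) (orbit_extension K) \<le>
      sqrt (4 * modulus (hausdorff_dist K L))"
    using eventually_body_filter
    by eventually_elim (intro real_le_rsqrt orbit_extension_hausdorff[OF K])
  have "((\<lambda>L. sqrt (4 * modulus (hausdorff_dist K L))) \<longlongrightarrow> sqrt (4 * 0)) (body_filter K)"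
    by (intro tendsto_intros tendsto_modulus tendsto_hausdorff_dist hausdorff_dist_nonneg)
  then show "((\<lambda>L. sqrt (4 * modulus (hausdorff_dist K L))) \<longlongrightarrow> 0) (body_filter K)"
    by simp
qed auto

end

section \<open>From invariant points to equivariant maps\<close>

lemma automorphism_invariant_normalization:
  fixes K :: "(real ^ 'n) set"
  assumes K: "K \<in> convex_bodies" and x: "automorphism_invariant K x"
  shows "stabilizer_fixed_point (normalize_body K) (normalization K x)"
proof
  let ?T = "normalization K"
  have T: "?T \<in> similarities"
    using K by (rule normalization_similarity)
  have bij: "inj ?T" "surj ?T"
    using T by (rule similarityE, simp)+
  fix U :: "real ^ 'n \<Rightarrow> real ^ 'n"
  assume U: "orthogonal_transformation U" "U ` normalize_body K = normalize_body K"
  \<comment> \<open>Conjugation by the normalization turns a stabilizer of the normalized body into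
    a similarity automorphism of \<open>K\<close>, which fixes \<open>x\<close>.\<close>
  have "inv ?T \<circ> (U \<circ> ?T) \<in> similarities"
    using similarities.inverse[OF T]
      similarities.comp[OF orthogonal_transformation_in_similarities[OF U(1)] T]
    by (rule similarities.comp)
  moreover have "(inv ?T \<circ> (U \<circ> ?T)) ` K = K"
    using U(2) by (simp only: normalize_body_def image_comp[symmetric] image_inv_f_f[OF bij(1)])
  ultimately have "(inv ?T \<circ> (U \<circ> ?T)) x = x"
    using x unfolding automorphism_invariant_def similarity_automorphisms_def by blast
  then have "inv ?T (U (?T x)) = x"
    by simp
  then show "U (?T x) = ?T x"
    using bij(2) by (metis surj_f_inv_f)
qed (rule normalize_body_convex_bodies[OF K])

text \<open>Continuity is kept in filter form so that \<open>tendsto_closest_point\<close> can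
  compose the map with the nearest-point projection.\<close>

lemma exists_similarity_equivariant:
  fixes K0 :: "(real ^ 'n) set"
  assumes K0: "K0 \<in> convex_bodies" and x0: "automorphism_invariant K0 x0"
  obtains p :: "(real ^ 'n) set \<Rightarrow> real ^ 'n"
  where "\<And>K. K \<in> convex_bodies \<Longrightarrow> (p \<longlongrightarrow> p K) (body_filter K)"
    "\<And>K A. \<lbrakk>K \<in> convex_bodies; A \<in> similarities\<rbrakk> \<Longrightarrow> p (A ` K) = A (p K)"
    "p K0 = x0"
proof
  interpret stabilizer_fixed_point "normalize_body K0" "normalization K0 x0"
    using K0 x0 by (rule automorphism_invariant_normalization)
  \<comment> \<open>The inverse of \<open>normalization K\<close> is applied to the extension
    evaluated at the normalized body.\<close>
  let ?p = "\<lambda>K. circumcenter K + circumradius K *\<^sub>R orbit_extension (normalize_body K)"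
  show "(?p \<longlongrightarrow> ?p K) (body_filter K)" if K: "K \<in> convex_bodies" for K
    using filterlim_compose[OF tendsto_orbit_extension[OF normalize_body_convex_bodies[OF K]]
        filterlim_normalize_body[OF K]]
    by (intro tendsto_intros tendsto_circumcenter[OF K] tendsto_circumradius[OF K])
  show "?p (A ` K) = A (?p K)" if K: "K \<in> convex_bodies" and A: "A \<in> similarities" for K A
  proof -
    obtain c U b where c: "c > 0" "orthogonal_transformation U" "A = (\<lambda>x. c *\<^sub>R U x + b)"
      using A by (rule similarityE)
    have lin: "linear U"
      using c(2) by (simp add: orthogonal_transformation)
    show ?thesis
      unfolding circumcenter_similarity[OF K A] normalize_body_similarity[OF K c A]
        orbit_extension_equivariant[OF c(2) normalize_body_convex_bodies[OF K]]
      by (simp add: c(3) linear_add[OF lin] linear_cmul[OF lin] scaleR_add_right)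
  qed
  show "?p K0 = x0"
    using circumradius_pos[OF K0] by (simp add: orbit_extension_base) (simp add: normalization_def)
qed

section \<open>Nearest points in a convex body\<close>

text \<open>A point \<open>b'\<close> of \<open>K\<close> near the nearest point of \<open>L\<close>
  is almost nearest to \<open>y\<close> within \<open>K\<close>. The angle at the nearest point of
  \<open>K\<close> between the directions to \<open>y\<close> and to \<open>b'\<close> is not acute,
  so the excess in squared distance controls how far \<open>b'\<close> is from that point.\<close>

lemma closest_point_hausdorff:
  fixes K L :: "(real ^ 'n) set"
  assumes K: "K \<in> convex_bodies" and L: "L \<in> convex_bodies"
  fixes y :: "real ^ 'n"
  defines "D \<equiv> dist y (closest_point K y)"
  shows "dist (closest_point L y) (closest_point K y) \<le>
    hausdorff_dist K L + sqrt ((D + 2 * hausdorff_dist K L)\<^sup>2 - D\<^sup>2)"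
proof -
  let ?a = "closest_point K y" and ?b = "closest_point L y" and ?\<delta> = "hausdorff_dist K L"
  note K' = convex_bodiesD[OF K] and L' = convex_bodiesD[OF L]
  have a: "?a \<in> K" and b: "?b \<in> L"
    using K' L' by (simp_all add: closest_point_in_set compact_imp_closed)
  obtain a' where a': "a' \<in> L" "dist ?a a' \<le> ?\<delta>"
    using hausdorff_dist_approx[OF K'(1) L'(1) K'(4) L'(4) a] by blast
  obtain b' where b': "b' \<in> K" "dist ?b b' \<le> ?\<delta>"
    using hausdorff_dist_approx[OF L'(1) K'(1) L'(4) K'(4) b] hausdorff_dist_commute by metis
  have "dist y ?b \<le> dist y a'"
    using a'(1) L' by (intro closest_point_le compact_imp_closed)
  \<comment> \<open>One summand \<delta> comes from replacing the nearest point of \<open>K\<close>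
    by \<open>a'\<close>, the other from replacing the nearest point of \<open>L\<close> by
    \<open>b'\<close>.\<close>
  then have "dist y b' \<le> D + 2 * ?\<delta>"
    using dist_triangle[of y a' ?a] dist_triangle[of y b' ?b] a'(2) b'(2) by (simp add: D_def)
  then have "(dist y b')\<^sup>2 \<le> (D + 2 * ?\<delta>)\<^sup>2"
    by (rule power_mono) simp
  moreover have "(dist b' ?a)\<^sup>2 + D\<^sup>2 \<le> (dist y b')\<^sup>2"
  proof -
    have "(y - ?a) \<bullet> (b' - ?a) \<le> 0"
      using K' b'(1) by (intro closest_point_dot compact_imp_closed)
    moreover have "(dist y b')\<^sup>2 = (dist b' ?a)\<^sup>2 + D\<^sup>2 - 2 * ((y - ?a) \<bullet> (b' - ?a))"
      unfolding D_def dist_norm power2_norm_eq_inner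
      by (simp add: inner_diff_left inner_diff_right inner_commute)
    ultimately show ?thesis
      by simp
  qed
  ultimately have "dist b' ?a \<le> sqrt ((D + 2 * ?\<delta>)\<^sup>2 - D\<^sup>2)"
    by (intro real_le_rsqrt) linarith
  then show ?thesis
    using b'(2) dist_triangle[of ?b ?a b'] by linarith
qed

text \<open>The change of the projected point costs at most the distance it moves, because
  projection onto a convex set is 1-Lipschitz. The change of the body is controlled by
  \<open>closest_point_hausdorff\<close> at the fixed point \<open>p K\<close>.\<close>

lemma tendsto_closest_point:
  fixes K :: "(real ^ 'n) set"
  assumes K: "K \<in> convex_bodies" and p: "(p \<longlongrightarrow> p K) (body_filter K)"
  shows "((\<lambda>L. closest_point L (p L)) \<longlongrightarrow> closest_point K (p K)) (body_filter K)"
proof (rule tendsto_dist_iff[THEN iffD2], rule tendsto_sandwich[where f = "\<lambda>_. 0"])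
  define D where "D = dist (p K) (closest_point K (p K))"
  let ?r = "\<lambda>L. dist (p L) (p K)
    + (hausdorff_dist K L + sqrt ((D + 2 * hausdorff_dist K L)\<^sup>2 - D\<^sup>2))"
  show "\<forall>\<^sub>F L in body_filter K. dist (closest_point L (p L)) (closest_point K (p K)) \<le> ?r L"
    using eventually_body_filter
  proof eventually_elim
    case (elim L)
    then have "dist (closest_point L (p L)) (closest_point L (p K)) \<le> dist (p L) (p K)"
      by (intro closest_point_lipschitz) (auto dest: convex_bodiesD compact_imp_closed)
    then show ?case
      using closest_point_hausdorff[OF K elim, of "p K"]
        dist_triangle[of "closest_point L (p L)" "closest_point K (p K)" "closest_point L (p K)"]
      unfolding D_def by linarith
  qed
  have "(?r \<longlongrightarrow> dist (p K) (p K) + (0 + sqrt ((D + 2 * 0)\<^sup>2 - D\<^sup>2))) (body_filter K)"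
    by (intro tendsto_intros p tendsto_hausdorff_dist)
  then show "(?r \<longlongrightarrow> 0) (body_filter K)"
    by simp
qed auto

lemma closest_point_similarity:
  assumes K: "K \<in> convex_bodies" and A: "A \<in> similarities"
  shows "closest_point (A ` K) (A y) = A (closest_point K y)"
proof (rule closest_point_unique[symmetric])
  note K' = convex_bodiesD[OF K] and AK = convex_bodiesD[OF image_similarity_convex_bodies[OF A K]]
  show "convex (A ` K)" "closed (A ` K)"
    using AK by (simp_all add: compact_imp_closed)
  show "A (closest_point K y) \<in> A ` K"
    using K' by (simp add: closest_point_in_set compact_imp_closed)
  obtain c where "c > 0" "\<And>x y. dist (A x) (A y) = c * dist x y"
    using A by (rule similarityE) blast
  then show "\<forall>z\<in>A ` K. dist (A y) (A (closest_point K y)) \<le> dist (A y) z"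
    using K' by (auto intro!: mult_left_mono closest_point_le compact_imp_closed)
qed

theorem corollary4:
  fixes K0 :: "(real ^ 'n) set"
  assumes "K0 \<in> convex_bodies"
  shows "(\<forall>x0 \<in> interior K0. automorphism_invariant K0 x0 \<longrightarrow>
            (\<exists>p. similarity_invariant_point_of_body p \<and> p K0 = x0))
       \<and> (\<forall>x0. automorphism_invariant K0 x0 \<longrightarrow>
            (\<exists>p. similarity_invariant_point p \<and> p K0 = x0))
       \<and> (\<forall>K \<in> (convex_bodies :: (real ^ 'n) set set).
            {x. automorphism_invariant K x} = {p K | p. similarity_invariant_point p})"
proof (intro conjI ballI allI impI)
  fix x0 assume "x0 \<in> interior K0" "automorphism_invariant K0 x0"
  obtain p where p: "\<And>K. K \<in> convex_bodies \<Longrightarrow> (p \<longlongrightarrow> p K) (body_filter K)"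
    "\<And>K A. \<lbrakk>K \<in> convex_bodies; A \<in> similarities\<rbrakk> \<Longrightarrow> p (A ` K) = A (p K)" "p K0 = x0"
    using exists_similarity_equivariant[OF assms \<open>automorphism_invariant K0 x0\<close>] by metis
  let ?q = "\<lambda>K. closest_point K (p K)"
  have "?q K \<in> K" if "K \<in> convex_bodies" for K
    using convex_bodiesD[OF that] by (simp add: closest_point_in_set compact_imp_closed)
  then have "similarity_invariant_point_of_body ?q"
    using p(1,2) by (simp add: similarity_invariant_point_of_body_def similarity_invariant_point_def
        continuous_map_convex_body_topologyI tendsto_closest_point closest_point_similarity)
  \<comment> \<open>Since \<open>x0\<close> already lies in \<open>K0\<close>, the projection leaves
    it unchanged.\<close>
  moreover have "?q K0 = x0"
    using \<open>x0 \<in> interior K0\<close> interior_subset by (auto simp: p(3) intro: closest_point_self)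
  ultimately show "\<exists>p. similarity_invariant_point_of_body p \<and> p K0 = x0"
    by blast
next
  have invariant_point: "\<exists>p. similarity_invariant_point p \<and> p K = x"
    if "K \<in> convex_bodies" "automorphism_invariant K x" for K :: "(real ^ 'n) set" and x
    using exists_similarity_equivariant[OF that] continuous_map_convex_body_topologyI
    unfolding similarity_invariant_point_def by metis
  then show "\<exists>p. similarity_invariant_point p \<and> p K0 = x0"
    if "automorphism_invariant K0 x0" for x0
    using assms that by blast
  show "{x. automorphism_invariant K x} = {p K | p. similarity_invariant_point p}"
    if K: "K \<in> convex_bodies" for K :: "(real ^ 'n) set"
  proof (intro equalityI subsetI)
    fix x assume "x \<in> {p K | p. similarity_invariant_point p}"
    then obtain p where p: "similarity_invariant_point p" "x = p K"
      by blast
    \<comment> \<open>For an automorphism \<open>A\<close> of \<open>K\<close> the body on the left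
      of the equivariance equation is again \<open>K\<close>, so the equation says that
      \<open>A\<close> fixes \<open>p K\<close>.\<close>
    have "A x = x" if "A \<in> similarities" "A ` K = K" for A
      using p K that unfolding similarity_invariant_point_def by metis
    then show "x \<in> {x. automorphism_invariant K x}"
      by (simp add: automorphism_invariant_def similarity_automorphisms_def)
  qed (use invariant_point[OF K] in blast)
qed

end
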